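(* For every $n\in\mathbb{N}$, there is exactly one Hamiltonian path through $T_{n+1}$, i.e. exactly one sequence of vertices visiting every vertex of $T_{n+1}$ exactly once such that consecutive vertices are joined by an edge of $T_{n+1}$ directed from the earlier to the later vertex. This path contains exactly one edge of dimension $0$ (i.e. between vertices differing in the first coordinate). Moreover, this single edge connects the Hamiltonian paths through the two copies of $T_n$ making up $T_{n+1}$: the part of the path before it is a Hamiltonian path of the full subgraph on the vertices with first coordinate $0$, and the part after it is a Hamiltonian path of the full subgraph on the vertices with first coordinate $1$.
   Context: A graph is $(V,E)$ with $E\subseteq V\times V$. The twisted $n$-cube $T_n$ is the graph with vertex set $\{0,1\}^n$ (sequences $x_0x_1\cdots x_{n-1}$) and edges: a loop at each vertex, and for each $i\in\{0,\dots,n-1\}$ and each $y\in\{0,1\}^{n-1}$ an edge from $y_0\cdots y_{i-1}\,b\,y_i\cdots y_{n-2}$ to $y_0\cdots y_{i-1}\,(1-b)\,y_i\cdots y_{n-2}$ (an edge of dimension $i$), where $b=1$ if the number of zeros among $y_0,\dots,y_{i-1}$ is odd and $b=0$ otherwise. Equivalently, $T_0$ is one vertex with a loop, and $T_{n+1}$ has vertices $\{0,1\}\times V(T_n)$ with edges $(0,t)\to(0,s)$ and $(1,s)\to(1,t)$ for each edge $s\to t$ of $T_n$ (so the subgraph on first coordinate $0$ is a copy of $T_n$ with all edges reversed and the subgraph on first coordinate $1$ is a copy of $T_n$), together with edges $(0,v)\to(1,v)$ for each vertex $v$ of $T_n$. *)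

theory Defs
  imports "Graph_Theory.Graph_Theory"
begin

definition bits :: "nat \<Rightarrow> nat list set" where
  "bits n = {x. length x = n \<and> set x \<subseteq> {0, 1}}"

text \<open>The edges of dimension \<open>i\<close> of the twisted \<open>n\<close>-cube. Only \<open>i < n\<close> is
  meaningful; \<open>Suc (length y) = n\<close> says that \<open>y\<close> has length \<open>n - 1\<close>
  without truncated subtraction.\<close>

definition twisted_dim_arcs :: "nat \<Rightarrow> nat \<Rightarrow> nat list rel" where
  "twisted_dim_arcs n i =
    {(take i y @ b # drop i y, take i y @ (1 - b) # drop i y) | y b.
       Suc (length y) = n \<and> set y \<subseteq> {0, 1} \<and>
       b = (if odd (count_list (take i y) 0) then 1 else 0)}"

definition twisted_cube :: "nat \<Rightarrow> nat list pair_pre_digraph" where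
  "twisted_cube n =
    \<lparr> pverts = bits n, parcs = Id_on (bits n) \<union> (\<Union>i<n. twisted_dim_arcs n i) \<rparr>"

definition hamiltonian_path :: "'a vwalk \<Rightarrow> ('a, 'b) pre_digraph \<Rightarrow> bool" where
  "hamiltonian_path p G \<longleftrightarrow> vpath p G \<and> set p = verts G"

definition first_coord_subgraph ::
    "nat \<Rightarrow> nat list pair_pre_digraph \<Rightarrow> (nat list, nat list \<times> nat list) pre_digraph" where
  "first_coord_subgraph c G = with_proj G \<restriction> {v \<in> pverts G. hd v = c}"

text \<open>The following lemmas show that the explicit description of the twisted cubes agrees with
  their recursive description, and that the two full subgraphs are copies of the smaller cube,
  the one with first coordinate \<open>0\<close> having its edges reversed.\<close>

lemma bits_0: "bits 0 = {[]}"
  by (auto simp: bits_def)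

lemma bits_Suc: "bits (Suc n) = (#) 0 ` bits n \<union> (#) 1 ` bits n"
  by (auto simp: bits_def length_Suc_conv image_iff)

lemma twisted_dim_arcs_0:
  "twisted_dim_arcs (Suc n) 0 = {(0 # v, 1 # v) | v. v \<in> bits n}"
  by (auto simp: twisted_dim_arcs_def bits_def)

lemma twisted_dim_arcs_Suc:
  assumes "i < n"
  shows "twisted_dim_arcs (Suc n) (Suc i) =
    {(0 # t, 0 # s) | s t. (s, t) \<in> twisted_dim_arcs n i} \<union>
    {(1 # s, 1 # t) | s t. (s, t) \<in> twisted_dim_arcs n i}"
  (is "?L = ?R")
proof (intro set_eqI iffI)
  fix e assume "e \<in> ?L"
  then obtain z b where z: "length z = n" "set z \<subseteq> {0, 1}"
    and b: "b = (if odd (count_list (take (Suc i) z) 0) then 1 else 0)"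
    and e: "e = (take (Suc i) z @ b # drop (Suc i) z, take (Suc i) z @ (1 - b) # drop (Suc i) z)"
    by (auto simp: twisted_dim_arcs_def)
  obtain c y where cy: "z = c # y" using z assms by (cases z) auto
  have c: "c = 0 \<or> c = 1" and y: "Suc (length y) = n" "set y \<subseteq> {0, 1}"
    using z cy by auto
  define b' :: nat where "b' = (if odd (count_list (take i y) 0) then 1 else 0)"
  have mem: "(take i y @ b' # drop i y, take i y @ (1 - b') # drop i y) \<in> twisted_dim_arcs n i"
    using y b'_def unfolding twisted_dim_arcs_def by blast
  have "b = (if c = 0 then 1 - b' else b')"
    using c by (auto simp: b cy b'_def)
  moreover have "1 - (1 - b') = b'" by (simp add: b'_def)
  ultimately show "e \<in> ?R" using c mem by (auto simp: e cy)
next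
  fix e assume "e \<in> ?R"
  then obtain s t and c :: nat where st: "(s, t) \<in> twisted_dim_arcs n i" and c: "c = 0 \<or> c = 1"
    and e0: "e = (if c = 0 then (0 # t, 0 # s) else (1 # s, 1 # t))"
    using that[where c = 0] that[where c = 1] by fastforce
  obtain y b where y: "Suc (length y) = n" "set y \<subseteq> {0, 1}"
    and b: "b = (if odd (count_list (take i y) 0) then 1 else 0)"
    and s: "s = take i y @ b # drop i y" and t: "t = take i y @ (1 - b) # drop i y"
    using st unfolding twisted_dim_arcs_def by blast
  define b' where
    "b' = (if odd (count_list (take (Suc i) (c # y)) 0) then 1 else 0 :: nat)"
  have "e = (take (Suc i) (c # y) @ b' # drop (Suc i) (c # y),
             take (Suc i) (c # y) @ (1 - b') # drop (Suc i) (c # y))"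
    using c by (auto simp: e0 s t b b'_def)
  moreover have "Suc (length (c # y)) = Suc n" "set (c # y) \<subseteq> {0, 1}"
    using y c by auto
  ultimately show "e \<in> ?L"
    using b'_def unfolding twisted_dim_arcs_def by blast
qed

lemma twisted_dim_arcs_subset:
  assumes "i < n" "e \<in> twisted_dim_arcs n i"
  shows "fst e \<in> bits n" "snd e \<in> bits n"
proof -
  obtain y b where y: "Suc (length y) = n" "set y \<subseteq> {0, 1}" and b: "b \<in> {0, 1}"
    and e: "e = (take i y @ b # drop i y, take i y @ (1 - b) # drop i y)"
    using assms(2) unfolding twisted_dim_arcs_def by auto
  have "set (take i y) \<subseteq> {0, 1}" "set (drop i y) \<subseteq> {0, 1}"
    using y(2) set_take_subset[of i y] set_drop_subset[of i y] by (metis subset_trans)+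
  then show "fst e \<in> bits n" "snd e \<in> bits n"
    using assms(1) y(1) b by (auto simp: e bits_def)
qed

lemma twisted_cube_0: "twisted_cube 0 = \<lparr> pverts = {[]}, parcs = {([], [])} \<rparr>"
  by (auto simp: twisted_cube_def bits_0)

lemma twisted_cube_Suc_verts:
  "pverts (twisted_cube (Suc n)) =
    (#) 0 ` pverts (twisted_cube n) \<union> (#) 1 ` pverts (twisted_cube n)"
  by (simp add: twisted_cube_def bits_Suc)

lemma twisted_cube_Suc_arcs:
  "parcs (twisted_cube (Suc n)) =
    {(0 # t, 0 # s) | s t. (s, t) \<in> parcs (twisted_cube n)} \<union>
    {(1 # s, 1 # t) | s t. (s, t) \<in> parcs (twisted_cube n)} \<union>
    {(0 # v, 1 # v) | v. v \<in> pverts (twisted_cube n)}"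
proof -
  have "(\<Union>i<Suc n. twisted_dim_arcs (Suc n) i) =
      twisted_dim_arcs (Suc n) 0 \<union> (\<Union>i<n. twisted_dim_arcs (Suc n) (Suc i))"
    by (simp add: lessThan_Suc_eq_insert_0)
  also have "(\<Union>i<n. twisted_dim_arcs (Suc n) (Suc i)) = (\<Union>i<n.
      {(0 # t, 0 # s) | s t. (s, t) \<in> twisted_dim_arcs n i} \<union>
      {(1 # s, 1 # t) | s t. (s, t) \<in> twisted_dim_arcs n i})"
    by (simp add: twisted_dim_arcs_Suc)
  finally have "parcs (twisted_cube (Suc n)) =
      Id_on ((#) 0 ` bits n \<union> (#) 1 ` bits n) \<union> {(0 # v, 1 # v) | v. v \<in> bits n} \<union>
      (\<Union>i<n. {(0 # t, 0 # s) | s t. (s, t) \<in> twisted_dim_arcs n i} \<union>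
      {(1 # s, 1 # t) | s t. (s, t) \<in> twisted_dim_arcs n i})"
    by (simp add: twisted_cube_def bits_Suc twisted_dim_arcs_0 Un_assoc)
  also have "Id_on ((#) 0 ` bits n \<union> (#) 1 ` bits n) =
      {(0 # t, 0 # s) | s t. (s, t) \<in> Id_on (bits n)} \<union>
      {(1 # s, 1 # t) | s t. (s, t) \<in> Id_on (bits n)}"
    by auto
  also have "(\<Union>i<n. {(0 # t, 0 # s) | s t. (s, t) \<in> twisted_dim_arcs n i} \<union>
        {(1 # s, 1 # t) | s t. (s, t) \<in> twisted_dim_arcs n i}) =
      {(0 # t, 0 # s) | s t. (s, t) \<in> (\<Union>i<n. twisted_dim_arcs n i)} \<union>
      {(1 # s, 1 # t) | s t. (s, t) \<in> (\<Union>i<n. twisted_dim_arcs n i)}"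
    by fast
  finally have *: "parcs (twisted_cube (Suc n)) =
      {(0 # t, 0 # s) | s t. (s, t) \<in> Id_on (bits n)} \<union>
      {(1 # s, 1 # t) | s t. (s, t) \<in> Id_on (bits n)} \<union>
      {(0 # v, 1 # v) | v. v \<in> bits n} \<union>
      ({(0 # t, 0 # s) | s t. (s, t) \<in> (\<Union>i<n. twisted_dim_arcs n i)} \<union>
      {(1 # s, 1 # t) | s t. (s, t) \<in> (\<Union>i<n. twisted_dim_arcs n i)})" .
  have "{f s t | s t. (s, t) \<in> A \<union> B} = {f s t | s t. (s, t) \<in> A} \<union> {f s t | s t. (s, t) \<in> B}"
    for f :: "nat list \<Rightarrow> nat list \<Rightarrow> nat list \<times> nat list" and A B
    by blast
  note un = this[of "\<lambda>s t. (0 # t, 0 # s)"] this[of "\<lambda>s t. (1 # s, 1 # t)"]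
  have cube: "parcs (twisted_cube n) = Id_on (bits n) \<union> (\<Union>i<n. twisted_dim_arcs n i)"
    "pverts (twisted_cube n) = bits n"
    by (simp_all add: twisted_cube_def)
  show ?thesis unfolding * cube un by (simp only: Un_ac)
qed

lemma twisted_cube_wf: "pair_wf_digraph (twisted_cube n)"
proof
  fix e assume "e \<in> parcs (twisted_cube n)"
  then have "e \<in> Id_on (bits n) \<or> (\<exists>i<n. e \<in> twisted_dim_arcs n i)"
    by (auto simp: twisted_cube_def)
  then have "fst e \<in> bits n \<and> snd e \<in> bits n"
    by (elim disjE exE conjE Id_onE) (simp_all add: twisted_dim_arcs_subset)
  then show "fst e \<in> pverts (twisted_cube n)" "snd e \<in> pverts (twisted_cube n)"
    by (simp_all add: twisted_cube_def)
qed


lemma first_coord_subgraph_0: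
  "verts (first_coord_subgraph 0 (twisted_cube (Suc n))) = (#) 0 ` pverts (twisted_cube n)"
  "arcs (first_coord_subgraph 0 (twisted_cube (Suc n))) =
    {(0 # t, 0 # s) | s t. (s, t) \<in> parcs (twisted_cube n)}"
proof -
  show verts:
    "verts (first_coord_subgraph 0 (twisted_cube (Suc n))) = (#) 0 ` pverts (twisted_cube n)"
    by (auto simp: first_coord_subgraph_def twisted_cube_Suc_verts)
  have "arcs (first_coord_subgraph 0 (twisted_cube (Suc n))) =
      {e \<in> parcs (twisted_cube (Suc n)). fst e \<in> (#) 0 ` pverts (twisted_cube n) \<and>
        snd e \<in> (#) 0 ` pverts (twisted_cube n)}"
    using verts by (simp add: first_coord_subgraph_def)
  then show "arcs (first_coord_subgraph 0 (twisted_cube (Suc n))) =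
      {(0 # t, 0 # s) | s t. (s, t) \<in> parcs (twisted_cube n)}"
    using pair_wf_digraph.in_arcsD1[OF twisted_cube_wf]
      pair_wf_digraph.in_arcsD2[OF twisted_cube_wf]
    by (simp only: twisted_cube_Suc_arcs) fastforce
qed

lemma first_coord_subgraph_1:
  "verts (first_coord_subgraph 1 (twisted_cube (Suc n))) = (#) 1 ` pverts (twisted_cube n)"
  "arcs (first_coord_subgraph 1 (twisted_cube (Suc n))) =
    {(1 # s, 1 # t) | s t. (s, t) \<in> parcs (twisted_cube n)}"
proof -
  show verts:
    "verts (first_coord_subgraph 1 (twisted_cube (Suc n))) = (#) 1 ` pverts (twisted_cube n)"
    by (auto simp: first_coord_subgraph_def twisted_cube_Suc_verts)
  have "arcs (first_coord_subgraph 1 (twisted_cube (Suc n))) =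
      {e \<in> parcs (twisted_cube (Suc n)). fst e \<in> (#) 1 ` pverts (twisted_cube n) \<and>
        snd e \<in> (#) 1 ` pverts (twisted_cube n)}"
    using verts by (simp add: first_coord_subgraph_def)
  then show "arcs (first_coord_subgraph 1 (twisted_cube (Suc n))) =
      {(1 # s, 1 # t) | s t. (s, t) \<in> parcs (twisted_cube n)}"
    using pair_wf_digraph.in_arcsD1[OF twisted_cube_wf]
      pair_wf_digraph.in_arcsD2[OF twisted_cube_wf]
    by (simp only: twisted_cube_Suc_arcs) fastforce
qed

end

theory Submission
  imports Defs
begin

text \<open>No arc of \<open>T\<^bsub>n+1\<^esub>\<close> leads from first coordinate \<open>1\<close> back to \<open>0\<close>, so a Hamiltonian path runs
  through the whole \<open>0\<close>-half, crosses once along an arc \<open>0v \<rightarrow> 1v\<close>, and runs through the whole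
  \<open>1\<close>-half. Undoing the reversal of the \<open>0\<close>-half, it consists of two Hamiltonian paths of \<open>T\<^bsub>n\<^esub>\<close>
  that both start at \<open>v\<close>. If \<open>T\<^bsub>n\<^esub>\<close> has exactly one Hamiltonian path \<open>q\<close>, both equal \<open>q\<close>, and their
  starting points agree automatically; so \<open>T\<^bsub>n+1\<^esub>\<close> has exactly one as well.\<close>

lemma set_vwalk_arcs_subset_iff:
  "set (vwalk_arcs p) \<subseteq> A \<longleftrightarrow> successively (\<lambda>x y. (x, y) \<in> A) p"
  by (induction p rule: vwalk_arcs.induct) auto

text \<open>Recasts paths through \<open>successively\<close>, whose rules for append, map and
  reversal allow a path to be cut and its pieces moved between cubes.\<close>

lemma hamiltonian_path_iff:
  "hamiltonian_path p G \<longleftrightarrow>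
    p \<noteq> [] \<and> distinct p \<and> set p = verts G \<and> successively (\<lambda>x y. (x, y) \<in> arcs_ends G) p"
  by (auto simp: hamiltonian_path_def vpath_def vwalk_def set_vwalk_arcs_subset_iff)

lemma hamiltonian_path_with_proj_iff:
  "hamiltonian_path p (with_proj G) \<longleftrightarrow>
    p \<noteq> [] \<and> distinct p \<and> set p = pverts G \<and> successively (\<lambda>x y. (x, y) \<in> parcs G) p"
  by (simp add: hamiltonian_path_iff arcs_ends_def arc_to_ends_def)

lemma arcs_ends_first_coord_subgraph:
  "arcs_ends (first_coord_subgraph c G) = arcs (first_coord_subgraph c G)"
  by (simp add: first_coord_subgraph_def arcs_ends_def arc_to_ends_def)

lemma twisted_cube_Suc_arcs_simps:
  "(0 # s, 0 # t) \<in> parcs (twisted_cube (Suc n)) \<longleftrightarrow> (t, s) \<in> parcs (twisted_cube n)"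
  "(1 # s, 1 # t) \<in> parcs (twisted_cube (Suc n)) \<longleftrightarrow> (s, t) \<in> parcs (twisted_cube n)"
  "(0 # s, 1 # t) \<in> parcs (twisted_cube (Suc n)) \<longleftrightarrow> s = t \<and> s \<in> pverts (twisted_cube n)"
  "(1 # s, 0 # t) \<notin> parcs (twisted_cube (Suc n))"
  by (auto simp: twisted_cube_Suc_arcs)

text \<open>Induction from the front: a vertex \<open>1 # v\<close> can only precede vertices with
  first coordinate 1, so prepending it forces \<open>a = []\<close>. Either piece may be empty here,
  as the walk need not visit every vertex.\<close>

lemma twisted_cube_Suc_walk_split:
  assumes "successively (\<lambda>x y. (x, y) \<in> parcs (twisted_cube (Suc n))) p"
    and "set p \<subseteq> pverts (twisted_cube (Suc n))"
  shows "\<exists>a b. p = map ((#) 0) a @ map ((#) 1) b"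
  using assms
proof (induction p)
  case Nil
  then show ?case by simp
next
  case (Cons x p)
  then obtain a b where p: "p = map ((#) 0) a @ map ((#) 1) b"
    by (auto simp: successively_Cons)
  from Cons.prems(2) consider v where "x = 0 # v" | v where "x = 1 # v"
    by (auto simp: twisted_cube_Suc_verts)
  then show ?case
  proof cases
    case 1
    then have "x # p = map ((#) 0) (v # a) @ map ((#) 1) b" by (simp add: p)
    then show ?thesis by blast
  next
    case 2
    have "a = []"
    proof (rule ccontr)
      assume "a \<noteq> []"
      then have "(1 # v, 0 # hd a) \<in> parcs (twisted_cube (Suc n))"
        using Cons.prems(1) by (simp add: p 2 successively_Cons hd_map)
      then show False by (simp only: twisted_cube_Suc_arcs_simps)
    qed
    then have "x # p = map ((#) 0) [] @ map ((#) 1) (v # b)" by (simp add: p 2)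
    then show ?thesis by blast
  qed
qed

text \<open>Reversing \<open>q\<close> undoes the reversal of arcs in the 0-half, so that half is
  left at \<open>0 # hd q\<close>. The condition \<open>hd q = hd r\<close> is exactly the existence
  of the crossing arc.\<close>

lemma hamiltonian_path_twisted_cube_Suc_iff:
  "hamiltonian_path p (with_proj (twisted_cube (Suc n))) \<longleftrightarrow>
    (\<exists>q r. hamiltonian_path q (with_proj (twisted_cube n)) \<and>
      hamiltonian_path r (with_proj (twisted_cube n)) \<and> hd q = hd r \<and>
      p = map ((#) 0) (rev q) @ map ((#) 1) r)"
  (is "?L \<longleftrightarrow> ?R")
proof -
  have join: "hamiltonian_path (map ((#) 0) (rev q) @ map ((#) 1) r)
        (with_proj (twisted_cube (Suc n))) \<longleftrightarrow>
      hamiltonian_path q (with_proj (twisted_cube n)) \<and>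
      hamiltonian_path r (with_proj (twisted_cube n)) \<and> hd q = hd r" for q r
  proof -
    let ?V = "pverts (twisted_cube n)"
    \<comment> \<open>Ensures that both halves of a covering path are nonempty, so that
      \<open>hd\<close> is meaningful and a crossing arc is really required.\<close>
    have "?V \<noteq> {}"
      by (auto simp: twisted_cube_def bits_def intro!: exI[of _ "replicate n 0"])
    have halves: "(#) (0::nat) ` set q \<union> (#) 1 ` set r = (#) 0 ` ?V \<union> (#) 1 ` ?V \<longleftrightarrow>
        set q = ?V \<and> set r = ?V"
    proof
      assume eq: "(#) (0::nat) ` set q \<union> (#) 1 ` set r = (#) 0 ` ?V \<union> (#) 1 ` ?V"
      \<comment> \<open>Testing the equation at \<open>0 # v\<close> and at \<open>1 # v\<close>
        separates the two halves.\<close>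
      have "v \<in> set q \<longleftrightarrow> v \<in> ?V" "v \<in> set r \<longleftrightarrow> v \<in> ?V" for v
        using arg_cong[OF eq, of "\<lambda>A. 0 # v \<in> A"] arg_cong[OF eq, of "\<lambda>A. 1 # v \<in> A"]
        by auto
      then show "set q = ?V \<and> set r = ?V" by blast
    qed simp
    show ?thesis
    \<comment> \<open>Each side of \<open>join\<close> forces this coverage, so both are false
      without it.\<close>
    proof (cases "set q = ?V \<and> set r = ?V")
      case True
      with \<open>?V \<noteq> {}\<close> have ne: "q \<noteq> []" "r \<noteq> []" by auto
      then have hd: "hd q \<in> ?V" using True by auto
      have dist: "distinct (map ((#) (0::nat)) (rev q) @ map ((#) 1) r) \<longleftrightarrow>
          distinct q \<and> distinct r"
        by (auto simp: distinct_map)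
      have succ: "successively (\<lambda>x y. (x, y) \<in> parcs (twisted_cube (Suc n)))
            (map ((#) 0) (rev q) @ map ((#) 1) r) \<longleftrightarrow>
          successively (\<lambda>x y. (x, y) \<in> parcs (twisted_cube n)) q \<and>
          successively (\<lambda>x y. (x, y) \<in> parcs (twisted_cube n)) r \<and>
          hd q = hd r \<and> hd q \<in> ?V"
      proof -
        have "last (map ((#) 0) (rev q)) = 0 # hd q" "hd (map ((#) 1) r) = 1 # hd r"
          using ne by (simp_all add: last_map last_rev hd_map)
        with ne show ?thesis
          \<comment> \<open>The append rule isolates the crossing arc at the junction; the rule for
            \<open>rev\<close> swaps the arguments of the relation and so cancels the reversed
            arcs.\<close>
          unfolding successively_append_iff successively_map successively_rev
          by (simp only: twisted_cube_Suc_arcs_simps) auto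
      qed
      have "set (map ((#) 0) (rev q) @ map ((#) 1) r) = pverts (twisted_cube (Suc n))"
        using True by (simp add: twisted_cube_Suc_verts)
      moreover have "map ((#) (0::nat)) (rev q) @ map ((#) 1) r \<noteq> []"
        using ne by simp
      ultimately show ?thesis
        unfolding hamiltonian_path_with_proj_iff dist succ using True ne hd by argo
    next
      case False
      then have "set (map ((#) 0) (rev q) @ map ((#) 1) r) \<noteq> pverts (twisted_cube (Suc n))"
        using halves by (simp only: set_append set_map set_rev twisted_cube_Suc_verts) argo
      then show ?thesis
        unfolding hamiltonian_path_with_proj_iff using False by argo
    qed
  qed
  show ?thesis
  proof
    assume L: ?L
    then obtain a b where p: "p = map ((#) 0) a @ map ((#) 1) b"
      using twisted_cube_Suc_walk_split[of n p] by (auto simp: hamiltonian_path_with_proj_iff)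
    then have "p = map ((#) 0) (rev (rev a)) @ map ((#) 1) b" by simp
    with L join show ?R by blast
  next
    assume ?R
    with join show ?L by blast
  qed
qed

lemma ex1_hamiltonian_path_twisted_cube:
  "\<exists>!p. hamiltonian_path p (with_proj (twisted_cube n))"
proof (induction n)
  case 0
  \<comment> \<open>The loop at the only vertex yields no longer path, since vertices may not
    repeat.\<close>
  have "hamiltonian_path p (with_proj (twisted_cube 0)) \<longleftrightarrow> p = [[]]" for p
    by (cases p; cases "tl p")
      (auto simp: hamiltonian_path_with_proj_iff twisted_cube_0 subset_singleton_iff)
  then show ?case by simp
next
  case (Suc n)
  then show ?case by (auto simp: hamiltonian_path_twisted_cube_Suc_iff)
qed

lemma hamiltonian_path_first_coord_subgraph:
  assumes "hamiltonian_path q (with_proj (twisted_cube n))"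
  shows "hamiltonian_path (map ((#) 0) (rev q)) (first_coord_subgraph 0 (twisted_cube (Suc n)))"
    and "hamiltonian_path (map ((#) 1) q) (first_coord_subgraph 1 (twisted_cube (Suc n)))"
  unfolding hamiltonian_path_iff arcs_ends_first_coord_subgraph
    first_coord_subgraph_0 first_coord_subgraph_1
  using assms
  by (auto simp: hamiltonian_path_with_proj_iff distinct_map successively_map)

theorem theorem3p6:
  fixes n :: nat
  shows "(\<exists>!p. hamiltonian_path p (with_proj (twisted_cube (n + 1)))) \<and>
    (\<forall>p. hamiltonian_path p (with_proj (twisted_cube (n + 1))) \<longrightarrow>
      (\<exists>!k. Suc k < length p \<and> (p ! k, p ! Suc k) \<in> twisted_dim_arcs (n + 1) 0) \<and>
      (\<forall>k. Suc k < length p \<and> (p ! k, p ! Suc k) \<in> twisted_dim_arcs (n + 1) 0 \<longrightarrow>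
        hamiltonian_path (take (Suc k) p) (first_coord_subgraph 0 (twisted_cube (n + 1))) \<and>
        hamiltonian_path (drop (Suc k) p) (first_coord_subgraph 1 (twisted_cube (n + 1)))))"
proof (intro conjI allI impI)
  show "\<exists>!p. hamiltonian_path p (with_proj (twisted_cube (n + 1)))"
    by (rule ex1_hamiltonian_path_twisted_cube)
next
  fix p assume "hamiltonian_path p (with_proj (twisted_cube (n + 1)))"
  then obtain q r where q: "hamiltonian_path q (with_proj (twisted_cube n))"
    and r: "hamiltonian_path r (with_proj (twisted_cube n))" and hd: "hd q = hd r"
    and p: "p = map ((#) 0) (rev q) @ map ((#) 1) r"
    by (auto simp: hamiltonian_path_twisted_cube_Suc_iff)
  have ne: "q \<noteq> []" "r \<noteq> []" and "hd q \<in> bits n"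
    using q r by (auto simp: hamiltonian_path_with_proj_iff twisted_cube_def)
  \<comment> \<open>Locates the arc of dimension 0 at the junction of the two halves, which gives
    both its uniqueness and the place to cut \<open>p\<close>.\<close>
  have crossing: "Suc k < length p \<and> (p ! k, p ! Suc k) \<in> twisted_dim_arcs (n + 1) 0 \<longleftrightarrow>
      Suc k = length q" for k
  proof
    assume k: "Suc k < length p \<and> (p ! k, p ! Suc k) \<in> twisted_dim_arcs (n + 1) 0"
    then have "hd (p ! k) = 0" "hd (p ! Suc k) = 1"
      by (auto simp: twisted_dim_arcs_0)
    \<comment> \<open>Entries of \<open>p\<close> start with 0 exactly at the indices below
      \<open>length q\<close>, so \<open>k\<close> is the last such index.\<close>
    with k show "Suc k = length q"
      by (auto simp: p nth_append split: if_splits)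
  next
    assume k: "Suc k = length q"
    then have "p ! k = 0 # hd q" "p ! Suc k = 1 # hd q"
      using ne hd by (auto simp: p nth_append rev_nth hd_conv_nth)
    then show "Suc k < length p \<and> (p ! k, p ! Suc k) \<in> twisted_dim_arcs (n + 1) 0"
      using k ne \<open>hd q \<in> bits n\<close> by (auto simp: p twisted_dim_arcs_0)
  qed
  show "\<exists>!k. Suc k < length p \<and> (p ! k, p ! Suc k) \<in> twisted_dim_arcs (n + 1) 0"
    \<comment> \<open>As \<open>q\<close> is nonempty, its length is a successor, so such a
      \<open>k\<close> exists.\<close>
    unfolding crossing using ne by (cases q) auto
  fix k assume "Suc k < length p \<and> (p ! k, p ! Suc k) \<in> twisted_dim_arcs (n + 1) 0"
  then have "Suc k = length q" by (simp only: crossing)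
  then have "take (Suc k) p = map ((#) 0) (rev q)" "drop (Suc k) p = map ((#) 1) r"
    by (simp_all add: p)
  then show "hamiltonian_path (take (Suc k) p) (first_coord_subgraph 0 (twisted_cube (n + 1)))"
    and "hamiltonian_path (drop (Suc k) p) (first_coord_subgraph 1 (twisted_cube (n + 1)))"
    using hamiltonian_path_first_coord_subgraph(1)[OF q]
      hamiltonian_path_first_coord_subgraph(2)[OF r] by simp_all
qed

end
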